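(* (Very high noise case.) There is an absolute constant $a>0$ such that the following holds. For every integer $K\ge2$ and all real $D,R\ge0$ there is a constant $C$ depending only on $K,D,R$ such that: for every $T\ge 1$, every $d$, every noise rates $\rho_0,\rho_1\in[0,1]$ with $\rho_0+\rho_1<1$, every sequence $(\mathbf{x}^t,y^t)_{t=1}^T$ with $\mathbf{x}^t\in\mathbb{R}^d$, $\|\mathbf{x}^t\|\le1$, $y^t\in[K]$, for which there is a matrix $W^*\in\mathbb{R}^{K\times d}$ with $\|W^*\|_F^2=D$ and $\sum_{t=1}^T L_H(W^*,(\mathbf{x}^t,y^t))\le R$, the algorithm RCNBF run with noise rates $\rho_0,\rho_1$ and $\gamma=a\,T^{-1/3}\beta^{-1}$ (where $\beta=1-\rho_0-\rho_1$), provided this $\gamma$ lies in $(0,0.5)$, makes an expected number of mistakes $$\mathbb{E}[M]=\mathbb{E}\left[\sum_{t=1}^T\mathbb{I}[\tilde y^t\ne y^t]\right]\le C\,T^{2/3}\beta^{-1}.$$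
   Context: Notation: $[K]=\{1,\dots,K\}$; $\mathbb{I}[A]$ is $1$ if $A$ holds and $0$ otherwise; $[a]_+=\max(0,a)$; $\|\cdot\|$ is the Euclidean norm and $\|\cdot\|_F$ the Frobenius norm. For $W\in\mathbb{R}^{K\times d}$ with rows $\mathbf{w}_1,\dots,\mathbf{w}_K$, the multiclass hinge loss is $L_H(W,(\mathbf{x},y))=\max_{j\ne y}[1-\mathbf{w}_y\cdot\mathbf{x}+\mathbf{w}_j\cdot\mathbf{x}]_+$. Algorithm RCNBF with parameters $\gamma\in(0,0.5)$, $\rho_0,\rho_1$: start with $W^1=0\in\mathbb{R}^{K\times d}$. At trial $t=1,\dots,T$: receive $\mathbf{x}^t$; set $\hat y^t=\arg\max_{r\in[K]}\mathbf{w}^t_r\cdot\mathbf{x}^t$ (ties broken by a fixed rule); set $P^t(r)=(1-\gamma)\mathbb{I}[r=\hat y^t]+\gamma/K$ for $r\in[K]$; sample $\tilde y^t\sim P^t$ (fresh randomness, given the past) and predict $\tilde y^t$. The true feedback is $f^t=\mathbb{I}[\tilde y^t=y^t]$, but the learner receives noisy feedback $f_\rho^t\in\{0,1\}$ whose law, given $\tilde y^t$ and the past, satisfies $P(f_\rho^t=1\mid f^t=0)=\rho_0$ and $P(f_\rho^t=0\mid f^t=1)=\rho_1$. Define $h(1)=\frac{1-\rho_0}{1-\rho_0-\rho_1}$, $h(0)=\frac{-\rho_0}{1-\rho_0-\rho_1}$. Update $W^{t+1}=W^t+H^t$, where $H^t_{r,j}=x^t_j\left(\frac{h(f_\rho^t)\,\mathbb{I}[\tilde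 y^t=r]}{P^t(r)}-\mathbb{I}[\hat y^t=r]\right)$. The expectation is over all the randomness (sampled labels and feedback noise). *)

theory Defs
  imports "HOL-Probability.Probability"
begin

(* Labels are {1..K} and coordinates are {1..d}.  Since K and d are quantified inside the
   statement, a vector in R^d is a function nat => real of which only the entries 1..d are used,
   and a K x d matrix is W :: nat => nat => real of which only the entries W r j with
   r in {1..K}, j in {1..d} are used.  Norms are L2_set over these index sets. *)

definition score :: "nat \<Rightarrow> (nat \<Rightarrow> nat \<Rightarrow> real) \<Rightarrow> (nat \<Rightarrow> real) \<Rightarrow> nat \<Rightarrow> real" where
  "score d W x r = (\<Sum>j=1..d. W r j * x j)"

definition frob_norm :: "nat \<Rightarrow> nat \<Rightarrow> (nat \<Rightarrow> nat \<Rightarrow> real) \<Rightarrow> real" where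
  "frob_norm K d W = L2_set (\<lambda>(r, j). W r j) ({1..K} \<times> {1..d})"

definition hinge_loss ::
  "nat \<Rightarrow> nat \<Rightarrow> (nat \<Rightarrow> nat \<Rightarrow> real) \<Rightarrow> (nat \<Rightarrow> real) \<Rightarrow> nat \<Rightarrow> real" where
  "hinge_loss K d W x y =
     Max ((\<lambda>j. max 0 (1 - score d W x y + score d W x j)) ` ({1..K} - {y}))"

(* A deterministic argmax over the labels: the choice among tied labels may be any
   function of the scores. *)
definition argmax_rule :: "nat \<Rightarrow> ((nat \<Rightarrow> real) \<Rightarrow> nat) \<Rightarrow> bool" where
  "argmax_rule K amax \<longleftrightarrow> (\<forall>s. is_arg_max s (\<lambda>r. r \<in> {1..K}) (amax s))"

definition label_prob :: "nat \<Rightarrow> real \<Rightarrow> nat \<Rightarrow> nat \<Rightarrow> real" where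
  "label_prob K \<gamma> yhat r = (1 - \<gamma>) * of_bool (r = yhat) + \<gamma> / real K"

definition label_pmf :: "nat \<Rightarrow> real \<Rightarrow> nat \<Rightarrow> nat pmf" where
  "label_pmf K \<gamma> yhat = embed_pmf (\<lambda>r. if r \<in> {1..K} then label_prob K \<gamma> yhat r else 0)"

lemma pmf_label_pmf:
  assumes "0 \<le> \<gamma>" "\<gamma> \<le> 1" "yhat \<in> {1..K}"
  shows "pmf (label_pmf K \<gamma> yhat) r = (if r \<in> {1..K} then label_prob K \<gamma> yhat r else 0)"
proof -
  let ?p = "\<lambda>r. if r \<in> {1..K} then label_prob K \<gamma> yhat r else 0"
  have nn: "0 \<le> ?p r" for r
    using assms by (auto simp: label_prob_def)
  have "(\<integral>\<^sup>+ r. ennreal (?p r) \<partial>count_space UNIV) = (\<Sum>r\<in>{1..K}. ennreal (?p r))"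
    by (subst nn_integral_count_space'[of "{1..K}"]) auto
  also have "\<dots> = ennreal (\<Sum>r\<in>{1..K}. ?p r)"
    by (rule sum_ennreal) (rule nn)
  also have "(\<Sum>r\<in>{1..K}. ?p r) = (\<Sum>r\<in>{1..K}. label_prob K \<gamma> yhat r)"
    by (rule sum.cong) auto
  also have "\<dots> = (1 - \<gamma>) * (\<Sum>r\<in>{1..K}. of_bool (r = yhat)) + \<gamma>"
    using assms(3) by (simp add: label_prob_def sum.distrib sum_distrib_left)
  also have "(\<Sum>r\<in>{1..K}. of_bool (r = yhat) :: real) = 1"
    using assms(3) by (simp add: of_bool_def)
  finally have "(\<integral>\<^sup>+ r. ennreal (?p r) \<partial>count_space UNIV) = 1"
    by simp
  with nn show ?thesis
    unfolding label_pmf_def by (rule pmf_embed_pmf)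
qed

(* Law of the noisy feedback, True standing for 1, given the predicted and the true label:
   P(True) is rho0 if the prediction is wrong and 1 - rho1 if it is right. *)
definition noisy_feedback :: "real \<Rightarrow> real \<Rightarrow> nat \<Rightarrow> nat \<Rightarrow> bool pmf" where
  "noisy_feedback \<rho>0 \<rho>1 ytilde y = bernoulli_pmf (if ytilde = y then 1 - \<rho>1 else \<rho>0)"

definition feedback_weight :: "real \<Rightarrow> real \<Rightarrow> bool \<Rightarrow> real" where
  "feedback_weight \<rho>0 \<rho>1 f = (if f then 1 - \<rho>0 else - \<rho>0) / (1 - \<rho>0 - \<rho>1)"

definition rcnbf_update ::
  "nat \<Rightarrow> real \<Rightarrow> real \<Rightarrow> real \<Rightarrow> (nat \<Rightarrow> real) \<Rightarrow> nat \<Rightarrow> nat \<Rightarrow> bool \<Rightarrow> nat \<Rightarrow> nat \<Rightarrow> real" where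
  "rcnbf_update K \<gamma> \<rho>0 \<rho>1 x yhat ytilde f r j =
     x j * (feedback_weight \<rho>0 \<rho>1 f * of_bool (ytilde = r) / label_prob K \<gamma> yhat r
            - of_bool (yhat = r))"

(* rcnbf K d amax gamma rho0 rho1 x y t is the joint law, after trials 1..t, of the predicted
   labels and of the matrix W^(t+1).  The label sequence is undefined outside {1..t}. *)
primrec rcnbf ::
  "nat \<Rightarrow> nat \<Rightarrow> ((nat \<Rightarrow> real) \<Rightarrow> nat) \<Rightarrow> real \<Rightarrow> real \<Rightarrow> real \<Rightarrow>
   (nat \<Rightarrow> nat \<Rightarrow> real) \<Rightarrow> (nat \<Rightarrow> nat) \<Rightarrow> nat \<Rightarrow> ((nat \<Rightarrow> nat) \<times> (nat \<Rightarrow> nat \<Rightarrow> real)) pmf" where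
  "rcnbf K d amax \<gamma> \<rho>0 \<rho>1 x y 0 = return_pmf (\<lambda>_. undefined, \<lambda>_ _. 0)"
| "rcnbf K d amax \<gamma> \<rho>0 \<rho>1 x y (Suc t) =
     do {
       (ys, W) \<leftarrow> rcnbf K d amax \<gamma> \<rho>0 \<rho>1 x y t;
       let yhat = amax (score d W (x (Suc t)));
       ytilde \<leftarrow> label_pmf K \<gamma> yhat;
       f \<leftarrow> noisy_feedback \<rho>0 \<rho>1 ytilde (y (Suc t));
       return_pmf (ys(Suc t := ytilde),
         \<lambda>r j. W r j + rcnbf_update K \<gamma> \<rho>0 \<rho>1 (x (Suc t)) yhat ytilde f r j)
     }"

definition expected_mistakes ::
  "nat \<Rightarrow> nat \<Rightarrow> ((nat \<Rightarrow> real) \<Rightarrow> nat) \<Rightarrow> real \<Rightarrow> real \<Rightarrow> real \<Rightarrow>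
   (nat \<Rightarrow> nat \<Rightarrow> real) \<Rightarrow> (nat \<Rightarrow> nat) \<Rightarrow> nat \<Rightarrow> real" where
  "expected_mistakes K d amax \<gamma> \<rho>0 \<rho>1 x y T =
     measure_pmf.expectation (rcnbf K d amax \<gamma> \<rho>0 \<rho>1 x y T)
       (\<lambda>(ys, W). \<Sum>t=1..T. of_bool (ys t \<noteq> y t))"

end

theory Submission
  imports Defs
begin

text \<open>
  Conditionally on the past, the reweighted feedback makes \<open>H\<^sup>t\<close> an unbiased estimate of the
  multiclass perceptron update, whose inner product with \<open>W\<^sup>*\<close> is at least
  \<open>I[yhat \<noteq> y] - L\<^sub>H\<close> and with \<open>W\<^sup>t\<close> at most \<open>0\<close>, while
  \<open>\<parallel>H\<^sup>t\<parallel>\<^sup>2\<close> has expectation at most \<open>2 (K\<^sup>2 / (\<gamma> \<beta>\<^sup>2) + 1)\<close>. Hence the potential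
  \<open>M - \<langle>W\<^sup>*, W\<rangle> + \<parallel>W\<parallel>\<^sup>2 / (2 c)\<close> grows in expectation by at most
  \<open>\<gamma> + L\<^sub>H + (K\<^sup>2 / (\<gamma> \<beta>\<^sup>2) + 1) / c\<close> per trial, and it is at least \<open>M - c \<parallel>W\<^sup>*\<parallel>\<^sup>2 / 2\<close>. The
  choice \<open>c = T\<^bsup>2/3\<^esup> / \<beta>\<close> balances the terms.
\<close>

section \<open>Frobenius inner product of matrices\<close>

definition matrix_inner ::
  "nat \<Rightarrow> nat \<Rightarrow> (nat \<Rightarrow> nat \<Rightarrow> real) \<Rightarrow> (nat \<Rightarrow> nat \<Rightarrow> real) \<Rightarrow> real" where
  "matrix_inner K d V W = (\<Sum>r=1..K. \<Sum>j=1..d. V r j * W r j)"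

lemma matrix_inner_add_right:
  "matrix_inner K d U (\<lambda>r j. V r j + W r j) = matrix_inner K d U V + matrix_inner K d U W"
  by (simp add: matrix_inner_def sum.distrib algebra_simps)

lemma matrix_inner_add_self:
  "matrix_inner K d (\<lambda>r j. V r j + W r j) (\<lambda>r j. V r j + W r j) =
     matrix_inner K d V V + 2 * matrix_inner K d V W + matrix_inner K d W W"
  unfolding matrix_inner_def
  by (simp add: sum.distrib algebra_simps flip: sum_distrib_left)

lemma matrix_inner_self_eq_frob_norm: "matrix_inner K d W W = (frob_norm K d W)\<^sup>2"
  by (simp add: matrix_inner_def frob_norm_def L2_set_def sum_nonneg sum.cartesian_product
      power2_eq_square case_prod_unfold)

text \<open>Every update is an outer product of the instance with a vector of label weights, so its
  inner products reduce to scores.\<close>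

lemma matrix_inner_rank_one:
  "matrix_inner K d V (\<lambda>r j. x j * g r) = (\<Sum>r=1..K. score d V x r * g r)"
  by (simp add: matrix_inner_def score_def sum_distrib_right mult.assoc)

lemma matrix_inner_rank_one_self:
  "matrix_inner K d (\<lambda>r j. x j * g r) (\<lambda>r j. x j * g r) =
     (L2_set x {1..d})\<^sup>2 * (\<Sum>r=1..K. (g r)\<^sup>2)"
proof -
  have "matrix_inner K d (\<lambda>r j. x j * g r) (\<lambda>r j. x j * g r) =
      (\<Sum>r=1..K. (\<Sum>j=1..d. (x j)\<^sup>2) * (g r)\<^sup>2)"
    by (simp add: matrix_inner_def sum_distrib_left sum_distrib_right power2_eq_square mult_ac)
  then show ?thesis
    by (simp add: L2_set_def sum_nonneg sum_distrib_left)
qed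

text \<open>Young's inequality, entry by entry. The free weight \<open>c\<close> later trades the
  size of the comparator against the growth of the learner's matrix.\<close>

lemma matrix_inner_le_weighted:
  assumes "c > 0"
  shows "matrix_inner K d U W \<le>
    c / 2 * matrix_inner K d U U + matrix_inner K d W W / (2 * c)"
proof -
  have "u * w \<le> c / 2 * (u * u) + w * w / (2 * c)" for u w :: real
  proof -
    have "0 \<le> (c * u - w)\<^sup>2 / (2 * c)"
      using assms by simp
    then show ?thesis
      using assms by (simp add: field_simps power2_eq_square)
  qed
  then have "matrix_inner K d U W \<le>
      (\<Sum>r=1..K. \<Sum>j=1..d. c / 2 * (U r j * U r j) + W r j * W r j / (2 * c))"
    unfolding matrix_inner_def by (intro sum_mono)
  then show ?thesis
    by (simp add: matrix_inner_def sum.distrib sum_distrib_left sum_divide_distrib)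
qed

section \<open>Margins and the multiclass hinge loss\<close>

lemma hinge_loss_ge_margin:
  assumes "j \<in> {1..K}" "y \<in> {1..K}" "j \<noteq> y"
  shows "1 - score d W x y + score d W x j \<le> hinge_loss K d W x y"
proof -
  have "max 0 (1 - score d W x y + score d W x j) \<le> hinge_loss K d W x y"
    unfolding hinge_loss_def using assms by (intro Max_ge) auto
  then show ?thesis by simp
qed

lemma hinge_loss_nonneg:
  assumes "K \<ge> 2" "y \<in> {1..K}"
  shows "0 \<le> hinge_loss K d W x y"
proof -
  \<comment> \<open>A second label exists because \<open>K \<ge> 2\<close>, so the maximum is taken
    over a nonempty set of nonnegative numbers.\<close>
  define j where "j = (if y = 1 then 2 else 1 :: nat)"
  have "j \<in> {1..K} - {y}"
    using assms by (auto simp: j_def)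
  then have "max 0 (1 - score d W x y + score d W x j) \<le> hinge_loss K d W x y"
    unfolding hinge_loss_def by (intro Max_ge) auto
  then show ?thesis by simp
qed

section \<open>Expectations over the sampled label and the noisy feedback\<close>

lemma expectation_bind_finite:
  fixes h :: "'b \<Rightarrow> real"
  assumes "finite (set_pmf p)" "\<And>x. x \<in> set_pmf p \<Longrightarrow> finite (set_pmf (f x))"
  shows "measure_pmf.expectation (p \<bind> f) h =
    measure_pmf.expectation p (\<lambda>x. measure_pmf.expectation (f x) h)"
  using assms by (simp add: pmf_expectation_bind[where A = "set_pmf p"]
      integral_measure_pmf[where A = "set_pmf p"])

lemma set_label_pmf:
  assumes "0 \<le> \<gamma>" "\<gamma> \<le> 1" "yhat \<in> {1..K}"
  shows "set_pmf (label_pmf K \<gamma> yhat) \<subseteq> {1..K}"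
  using assms by (auto simp: set_pmf_eq pmf_label_pmf split: if_splits)

lemma expectation_label_pmf:
  assumes "0 \<le> \<gamma>" "\<gamma> \<le> 1" "yhat \<in> {1..K}"
  shows "measure_pmf.expectation (label_pmf K \<gamma> yhat) F =
    (\<Sum>r=1..K. label_prob K \<gamma> yhat r * F r)"
  using set_label_pmf[OF assms]
  by (subst integral_measure_pmf[where A = "{1..K}"]) (auto simp: pmf_label_pmf[OF assms])

lemma sum_label_prob_mult:
  assumes "yhat \<in> {1..K}"
  shows "(\<Sum>r=1..K. label_prob K \<gamma> yhat r * F r) =
    (1 - \<gamma>) * F yhat + \<gamma> / real K * (\<Sum>r=1..K. F r)"
proof -
  have "(\<Sum>r=1..K. of_bool (r = yhat) * F r) = F yhat"
    using assms by (simp add: of_bool_def if_distrib[of "\<lambda>z. z * _"] sum.delta cong: if_cong)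
  moreover have "(\<Sum>r=1..K. label_prob K \<gamma> yhat r * F r) =
      (1 - \<gamma>) * (\<Sum>r=1..K. of_bool (r = yhat) * F r) + \<gamma> / real K * (\<Sum>r=1..K. F r)"
    by (simp only: label_prob_def distrib_right sum.distrib sum_distrib_left mult.assoc)
  ultimately show ?thesis by simp
qed

lemma label_prob_ge:
  assumes "\<gamma> \<le> 1"
  shows "\<gamma> / real K \<le> label_prob K \<gamma> yhat r"
  using assms by (simp add: label_prob_def)

text \<open>The greedy part of the label law errs only if \<open>yhat\<close> does; the uniform part
  has total mass \<gamma>, which is the price of exploration.\<close>

lemma mistake_prob_le:
  assumes "0 \<le> \<gamma>" "\<gamma> \<le> 1" "yhat \<in> {1..K}"
  shows "(\<Sum>r=1..K. label_prob K \<gamma> yhat r * of_bool (r \<noteq> y)) \<le> of_bool (yhat \<noteq> y) + \<gamma>"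
proof -
  have "(\<Sum>r=1..K. of_bool (r \<noteq> y) :: real) \<le> (\<Sum>r=1..K. 1)"
    by (intro sum_mono) auto
  then have "\<gamma> / real K * (\<Sum>r=1..K. of_bool (r \<noteq> y)) \<le> \<gamma> / real K * real K"
    using assms by (intro mult_left_mono) auto
  then have "\<gamma> / real K * (\<Sum>r=1..K. of_bool (r \<noteq> y)) \<le> \<gamma>"
    using assms by (cases "K = 0") auto
  then show ?thesis
    using assms by (subst sum_label_prob_mult) auto
qed

text \<open>The feedback weight is an unbiased estimate of the true feedback: (1 - \<rho>1)(1 -
  \<rho>0) - \<rho>1 \<rho>0 = 1 - \<rho>0 - \<rho>1 for a right label, \<rho>0 (1 - \<rho>0) - (1 -
  \<rho>0) \<rho>0 = 0 for a wrong one. The affine form is the one in which the weight enters the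
  potential bound.\<close>

lemma expectation_feedback_weight:
  assumes "\<rho>0 \<in> {0..1}" "\<rho>1 \<in> {0..1}" "\<rho>0 + \<rho>1 < 1"
  shows "measure_pmf.expectation (noisy_feedback \<rho>0 \<rho>1 r y)
      (\<lambda>f. a + b * feedback_weight \<rho>0 \<rho>1 f) = a + b * of_bool (r = y)"
proof -
  have "1 - \<rho>0 - \<rho>1 \<noteq> 0"
    using assms by simp
  then show ?thesis
    using assms by (simp add: noisy_feedback_def feedback_weight_def field_simps)
qed

lemma feedback_weight_square_le:
  assumes "\<rho>0 \<in> {0..1}"
  shows "(feedback_weight \<rho>0 \<rho>1 f)\<^sup>2 \<le> 1 / (1 - \<rho>0 - \<rho>1)\<^sup>2"
proof -
  have "(if f then 1 - \<rho>0 else - \<rho>0)\<^sup>2 \<le> 1"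
    using assms by (auto simp: abs_square_le_1)
  then show ?thesis
    by (simp add: feedback_weight_def power_divide divide_right_mono)
qed

section \<open>Inner products and size of the update\<close>

text \<open>Only the rows of the sampled and the greedy label can be nonzero. Their contributions
  add up also when the two labels coincide.\<close>

lemma matrix_inner_update:
  assumes "yhat \<in> {1..K}" "r \<in> {1..K}"
  shows "matrix_inner K d V (rcnbf_update K \<gamma> \<rho>0 \<rho>1 x yhat r f) =
    feedback_weight \<rho>0 \<rho>1 f / label_prob K \<gamma> yhat r * score d V x r - score d V x yhat"
proof -
  let ?g = "\<lambda>q. feedback_weight \<rho>0 \<rho>1 f * of_bool (r = q) / label_prob K \<gamma> yhat q
            - of_bool (yhat = q)"
  have "matrix_inner K d V (rcnbf_update K \<gamma> \<rho>0 \<rho>1 x yhat r f) =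
      (\<Sum>q=1..K. score d V x q * ?g q)"
    unfolding matrix_inner_rank_one[symmetric] by (simp add: matrix_inner_def rcnbf_update_def)
  also have "\<dots> = (\<Sum>q=1..K. (if r = q then score d V x q * feedback_weight \<rho>0 \<rho>1 f
        / label_prob K \<gamma> yhat q else 0) - (if yhat = q then score d V x q else 0))"
    by (intro sum.cong) (auto simp: algebra_simps)
  finally show ?thesis
    using assms by (simp add: sum_subtractf mult.commute)
qed

lemma matrix_inner_update_self_le:
  assumes "yhat \<in> {1..K}" "r \<in> {1..K}" "L2_set x {1..d} \<le> 1" "\<rho>0 \<in> {0..1}"
  shows "matrix_inner K d (rcnbf_update K \<gamma> \<rho>0 \<rho>1 x yhat r f)
      (rcnbf_update K \<gamma> \<rho>0 \<rho>1 x yhat r f) \<le>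
    2 * (1 / ((1 - \<rho>0 - \<rho>1)\<^sup>2 * (label_prob K \<gamma> yhat r)\<^sup>2) + 1)"
proof -
  define h where "h = feedback_weight \<rho>0 \<rho>1 f"
  let ?P = "label_prob K \<gamma> yhat"
  let ?g = "\<lambda>q. h * of_bool (r = q) / ?P q - of_bool (yhat = q)"
  have "matrix_inner K d (rcnbf_update K \<gamma> \<rho>0 \<rho>1 x yhat r f)
      (rcnbf_update K \<gamma> \<rho>0 \<rho>1 x yhat r f) = (L2_set x {1..d})\<^sup>2 * (\<Sum>q=1..K. (?g q)\<^sup>2)"
    unfolding matrix_inner_rank_one_self[symmetric]
    by (simp add: matrix_inner_def rcnbf_update_def h_def)
  also have "\<dots> \<le> 1 * (\<Sum>q=1..K. (?g q)\<^sup>2)"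
    using assms(3) by (intro mult_right_mono sum_nonneg)
      (auto simp: power_le_one L2_set_nonneg)
  \<comment> \<open>Bounding (a - b)^2 by 2 (a^2 + b^2) avoids treating the case
    \<open>r = yhat\<close> separately. The factor 2 cancels later against the 2 in
    \<open>2 * c\<close>.\<close>
  also have "\<dots> \<le> 1 * (\<Sum>q=1..K. 2 * ((if r = q then (h / ?P q)\<^sup>2 else 0)
      + (if yhat = q then 1 else 0)))"
  proof (intro mult_left_mono sum_mono)
    fix q
    have "(a - b)\<^sup>2 \<le> 2 * (a\<^sup>2 + b\<^sup>2)" for a b :: real
      using zero_le_power2[of "a + b"] by (simp add: power2_eq_square algebra_simps)
    from this[of "h * of_bool (r = q) / ?P q" "of_bool (yhat = q)"]
    show "(?g q)\<^sup>2 \<le> 2 * ((if r = q then (h / ?P q)\<^sup>2 else 0) + (if yhat = q then 1 else 0))"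
      by (auto split: if_splits)
  qed simp
  also have "\<dots> = 2 * ((h / ?P r)\<^sup>2 + 1)"
    using assms by (simp add: sum.distrib flip: sum_distrib_left)
  also have "\<dots> = 2 * (h\<^sup>2 * (1 / (?P r)\<^sup>2) + 1)"
    by (simp add: power_divide)
  also have "\<dots> \<le> 2 * (1 / (1 - \<rho>0 - \<rho>1)\<^sup>2 * (1 / (?P r)\<^sup>2) + 1)"
    using feedback_weight_square_le[OF assms(4)] unfolding h_def
    by (intro mult_left_mono add_right_mono mult_right_mono) auto
  finally show ?thesis by simp
qed

text \<open>Averaging the inverse square of a probability leaves its inverse, which exploration
  keeps below K / \<gamma>. The sum over the K labels gives the second factor K.\<close>

lemma expectation_importance_weight_square_le:
  assumes "0 < \<gamma>" "\<gamma> \<le> 1" "yhat \<in> {1..K}" "0 < \<beta>"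
  shows "(\<Sum>r=1..K. label_prob K \<gamma> yhat r * (1 / (\<beta>\<^sup>2 * (label_prob K \<gamma> yhat r)\<^sup>2))) \<le>
    (real K)\<^sup>2 / (\<gamma> * \<beta>\<^sup>2)"
proof -
  have K: "real K > 0"
    using assms by auto
  have "label_prob K \<gamma> yhat r * (1 / (\<beta>\<^sup>2 * (label_prob K \<gamma> yhat r)\<^sup>2)) \<le> real K / (\<gamma> * \<beta>\<^sup>2)" for r
  proof -
    have pos: "0 < \<gamma> / real K"
      using assms K by simp
    have P: "\<gamma> / real K \<le> label_prob K \<gamma> yhat r"
      using assms by (intro label_prob_ge) auto
    then have P_pos: "0 < label_prob K \<gamma> yhat r"
      using pos by linarith
    have "label_prob K \<gamma> yhat r * (1 / (\<beta>\<^sup>2 * (label_prob K \<gamma> yhat r)\<^sup>2)) =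
        1 / label_prob K \<gamma> yhat r / \<beta>\<^sup>2"
      using P_pos assms by (simp add: field_simps power2_eq_square)
    also have "\<dots> \<le> 1 / (\<gamma> / real K) / \<beta>\<^sup>2"
      using P P_pos pos by (intro divide_right_mono divide_left_mono mult_pos_pos) simp_all
    finally show ?thesis by simp
  qed
  then have "(\<Sum>r=1..K. label_prob K \<gamma> yhat r * (1 / (\<beta>\<^sup>2 * (label_prob K \<gamma> yhat r)\<^sup>2))) \<le>
      (\<Sum>r=1..K. real K / (\<gamma> * \<beta>\<^sup>2))"
    by (intro sum_mono)
  then show ?thesis
    by (simp add: power2_eq_square)
qed

section \<open>The potential and its increment\<close>

definition potential ::
  "nat \<Rightarrow> nat \<Rightarrow> (nat \<Rightarrow> nat) \<Rightarrow> (nat \<Rightarrow> nat \<Rightarrow> real) \<Rightarrow> real \<Rightarrow> nat \<Rightarrow>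
   (nat \<Rightarrow> nat) \<times> (nat \<Rightarrow> nat \<Rightarrow> real) \<Rightarrow> real" where
  "potential K d y U c t = (\<lambda>(ys, W). (\<Sum>s=1..t. of_bool (ys s \<noteq> y s))
     - matrix_inner K d U W + matrix_inner K d W W / (2 * c))"

text \<open>The quadratic term of the potential pays for the inner product with \<open>U\<close>, up
  to a constant that depends neither on the run nor on \<open>t\<close>.\<close>

lemma mistakes_le_potential:
  assumes "c > 0"
  shows "(case s of (ys, W) \<Rightarrow> \<Sum>s=1..t. of_bool (ys s \<noteq> y s)) \<le>
    potential K d y U c t s + c / 2 * matrix_inner K d U U"
  using matrix_inner_le_weighted[OF assms, of K d U "snd s"]
  by (simp add: potential_def case_prod_unfold)

text \<open>The new label is written at index \<open>Suc t\<close>, so the first \<open>t\<close>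
  mistake indicators are untouched. The cross term of the expanded square supplies the inner product
  of \<open>W\<close> with the update.\<close>

lemma potential_step:
  "potential K d y U c (Suc t) (ys(Suc t := r), \<lambda>q j. W q j + H q j) =
     potential K d y U c t (ys, W) + (of_bool (r \<noteq> y (Suc t))
       - matrix_inner K d U H + (2 * matrix_inner K d W H + matrix_inner K d H H) / (2 * c))"
  unfolding potential_def prod.case matrix_inner_add_self
  by (simp add: matrix_inner_add_right add_divide_distrib)

section \<open>One trial as a Markov kernel\<close>

text \<open>With the trial isolated as a kernel, conditioning on the past means evaluating the
  kernel at a fixed state.\<close>

definition rcnbf_step ::
  "nat \<Rightarrow> nat \<Rightarrow> ((nat \<Rightarrow> real) \<Rightarrow> nat) \<Rightarrow> real \<Rightarrow> real \<Rightarrow> real \<Rightarrow>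
   (nat \<Rightarrow> nat \<Rightarrow> real) \<Rightarrow> (nat \<Rightarrow> nat) \<Rightarrow> nat \<Rightarrow> (nat \<Rightarrow> nat) \<times> (nat \<Rightarrow> nat \<Rightarrow> real) \<Rightarrow>
   ((nat \<Rightarrow> nat) \<times> (nat \<Rightarrow> nat \<Rightarrow> real)) pmf" where
  "rcnbf_step K d amax \<gamma> \<rho>0 \<rho>1 x y t = (\<lambda>(ys, W).
     let yhat = amax (score d W (x (Suc t)))
     in label_pmf K \<gamma> yhat \<bind> (\<lambda>r. noisy_feedback \<rho>0 \<rho>1 r (y (Suc t)) \<bind> (\<lambda>f.
       return_pmf (ys(Suc t := r),
         \<lambda>q j. W q j + rcnbf_update K \<gamma> \<rho>0 \<rho>1 (x (Suc t)) yhat r f q j))))"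

lemma rcnbf_Suc:
  "rcnbf K d amax \<gamma> \<rho>0 \<rho>1 x y (Suc t) =
     rcnbf K d amax \<gamma> \<rho>0 \<rho>1 x y t \<bind> rcnbf_step K d amax \<gamma> \<rho>0 \<rho>1 x y t"
  by (simp add: rcnbf_step_def)

lemma argmax_rule_in_labels: "argmax_rule K amax \<Longrightarrow> amax s \<in> {1..K}"
  by (simp add: argmax_rule_def is_arg_max_def)

lemma argmax_rule_ge: "argmax_rule K amax \<Longrightarrow> r \<in> {1..K} \<Longrightarrow> s r \<le> s (amax s)"
  by (auto simp: argmax_rule_def is_arg_max_def not_less)

lemma finite_set_rcnbf_step:
  assumes "0 \<le> \<gamma>" "\<gamma> \<le> 1" "argmax_rule K amax"
  shows "finite (set_pmf (rcnbf_step K d amax \<gamma> \<rho>0 \<rho>1 x y t s))"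
proof -
  have "finite (set_pmf (label_pmf K \<gamma> (amax u)))" for u
    using set_label_pmf[OF assms(1,2) argmax_rule_in_labels[OF assms(3)]]
    by (rule finite_subset) simp
  then show ?thesis
    by (auto simp: rcnbf_step_def Let_def case_prod_unfold)
qed

lemma finite_set_rcnbf:
  assumes "0 \<le> \<gamma>" "\<gamma> \<le> 1" "argmax_rule K amax"
  shows "finite (set_pmf (rcnbf K d amax \<gamma> \<rho>0 \<rho>1 x y t))"
proof (induction t)
  case (Suc t)
  then show ?case
    unfolding rcnbf_Suc by (simp add: finite_set_rcnbf_step assms)
qed simp

text \<open>At a fixed state \<open>yhat\<close> is deterministic, so only label and feedback are
  random. The feedback stays inside an expectation, ready for
  \<open>expectation_feedback_weight\<close>.\<close>

lemma expectation_rcnbf_step: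
  fixes F :: "(nat \<Rightarrow> nat) \<times> (nat \<Rightarrow> nat \<Rightarrow> real) \<Rightarrow> real"
  assumes "0 \<le> \<gamma>" "\<gamma> \<le> 1" "argmax_rule K amax" "yhat = amax (score d W (x (Suc t)))"
  shows "measure_pmf.expectation (rcnbf_step K d amax \<gamma> \<rho>0 \<rho>1 x y t (ys, W)) F =
    (\<Sum>r=1..K. label_prob K \<gamma> yhat r *
      measure_pmf.expectation (noisy_feedback \<rho>0 \<rho>1 r (y (Suc t))) (\<lambda>f. F (ys(Suc t := r),
         \<lambda>q j. W q j + rcnbf_update K \<gamma> \<rho>0 \<rho>1 (x (Suc t)) yhat r f q j)))"
proof -
  have yhat: "yhat \<in> {1..K}"
    using assms by (simp only: argmax_rule_in_labels)
  have fin: "finite (set_pmf (label_pmf K \<gamma> yhat))"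
    using set_label_pmf[OF assms(1,2) yhat] by (rule finite_subset) simp
  show ?thesis
    by (simp add: rcnbf_step_def expectation_bind_finite fin Let_def flip: assms(4))
       (simp add: expectation_label_pmf[OF assms(1,2) yhat])
qed

section \<open>Expected drift of the potential\<close>

lemma expectation_potential_step_le:
  assumes \<rho>: "\<rho>0 \<in> {0..1}" "\<rho>1 \<in> {0..1}" "\<rho>0 + \<rho>1 < 1"
    and \<gamma>: "0 < \<gamma>" "\<gamma> \<le> 1" and amax: "argmax_rule K amax" and K: "K \<ge> 2"
    and x: "L2_set (x (Suc t)) {1..d} \<le> 1" and y: "y (Suc t) \<in> {1..K}" and c: "c > 0"
  shows "measure_pmf.expectation (rcnbf_step K d amax \<gamma> \<rho>0 \<rho>1 x y t s)
      (potential K d y U c (Suc t)) \<le>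
    potential K d y U c t s + (\<gamma> + hinge_loss K d U (x (Suc t)) (y (Suc t))
      + ((real K)\<^sup>2 / (\<gamma> * (1 - \<rho>0 - \<rho>1)\<^sup>2) + 1) / c)"
proof -
  obtain ys W where s: "s = (ys, W)" by fastforce
  define \<beta> where "\<beta> = 1 - \<rho>0 - \<rho>1"
  have \<beta>: "\<beta> > 0" using \<rho> by (simp add: \<beta>_def)
  define yhat where "yhat = amax (score d W (x (Suc t)))"
  let ?x = "x (Suc t)" and ?y = "y (Suc t)"
  let ?P = "label_prob K \<gamma> yhat"
  let ?H = "\<lambda>r f. rcnbf_update K \<gamma> \<rho>0 \<rho>1 ?x yhat r f"
  let ?L = "hinge_loss K d U ?x ?y"
  \<comment> \<open>Score of the matrix \<open>W / c - U\<close>: it merges the two linear terms of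
    the increment, which will average to \<open>v ?y - v yhat\<close>.\<close>
  define v where "v = (\<lambda>r. score d W ?x r / c - score d U ?x r)"
  define A where "A = potential K d y U c t s"
  define B where
    \<comment> \<open>The part of the increment bound that does not involve the feedback, so that
      what remains is linear in the feedback weight.\<close>
    "B = (\<lambda>r. of_bool (r \<noteq> ?y) - v yhat + (1 / (\<beta>\<^sup>2 * (?P r)\<^sup>2) + 1) / c)"
  have yhat: "yhat \<in> {1..K}"
    unfolding yhat_def using amax by (rule argmax_rule_in_labels)
  have P_pos: "?P r > 0" for r
    using label_prob_ge[OF \<gamma>(2), of K yhat r] \<gamma> K
    by (smt (verit, best) divide_pos_pos of_nat_0_less_iff not_numeral_le_zero not_gr_zero)
  have increment: "potential K d y U c (Suc t) (ys(Suc t := r), \<lambda>q j. W q j + ?H r f q j) \<le>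
      A + B r + v r / ?P r * feedback_weight \<rho>0 \<rho>1 f" if r: "r \<in> {1..K}" for r f
  proof -
    have "matrix_inner K d (?H r f) (?H r f) / (2 * c) \<le>
        2 * (1 / (\<beta>\<^sup>2 * (?P r)\<^sup>2) + 1) / (2 * c)"
      unfolding \<beta>_def using matrix_inner_update_self_le[OF yhat r x \<rho>(1)] c
      by (intro divide_right_mono) auto
    then have "matrix_inner K d (?H r f) (?H r f) / (2 * c) \<le> (1 / (\<beta>\<^sup>2 * (?P r)\<^sup>2) + 1) / c"
      by (simp only: mult_divide_mult_cancel_left_if) simp
    then have "potential K d y U c (Suc t) (ys(Suc t := r), \<lambda>q j. W q j + ?H r f q j) \<le>
        A + (of_bool (r \<noteq> ?y) - matrix_inner K d U (?H r f) + matrix_inner K d W (?H r f) / c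
          + (1 / (\<beta>\<^sup>2 * (?P r)\<^sup>2) + 1) / c)"
      unfolding potential_step A_def s by (simp add: add_divide_distrib)
    also have "\<dots> = A + B r + v r / ?P r * feedback_weight \<rho>0 \<rho>1 f"
      unfolding matrix_inner_update[OF yhat r] B_def v_def
      by (simp add: algebra_simps add_divide_distrib diff_divide_distrib)
    finally show ?thesis .
  qed
  have "measure_pmf.expectation (rcnbf_step K d amax \<gamma> \<rho>0 \<rho>1 x y t s)
      (potential K d y U c (Suc t)) = (\<Sum>r=1..K. ?P r *
      measure_pmf.expectation (noisy_feedback \<rho>0 \<rho>1 r ?y) (\<lambda>f. potential K d y U c (Suc t)
        (ys(Suc t := r), \<lambda>q j. W q j + ?H r f q j)))"
    unfolding s using \<gamma> by (intro expectation_rcnbf_step amax yhat_def) auto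
  also have "\<dots> \<le> (\<Sum>r=1..K. ?P r *
      measure_pmf.expectation (noisy_feedback \<rho>0 \<rho>1 r ?y)
        (\<lambda>f. A + B r + v r / ?P r * feedback_weight \<rho>0 \<rho>1 f))"
    using increment P_pos[THEN less_imp_le]
    by (intro sum_mono mult_left_mono integral_mono integrable_measure_pmf_finite finite) simp_all
  also have "\<dots> = (\<Sum>r=1..K. ?P r * (A + B r + v r / ?P r * of_bool (r = ?y)))"
    by (simp only: expectation_feedback_weight[OF \<rho>])
  \<comment> \<open>The sampling probability cancels the importance weight, so only the true label
    contributes to the \<open>v r\<close> term.\<close>
  also have "\<dots> = (\<Sum>r=1..K. ?P r * (A - v yhat + 1 / c) + ?P r * of_bool (r \<noteq> ?y)
      + ?P r * (1 / (\<beta>\<^sup>2 * (?P r)\<^sup>2)) / c + (if r = ?y then v r else 0))"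
  proof (intro sum.cong refl)
    fix r
    show "?P r * (A + B r + v r / ?P r * of_bool (r = ?y)) =
      ?P r * (A - v yhat + 1 / c) + ?P r * of_bool (r \<noteq> ?y)
      + ?P r * (1 / (\<beta>\<^sup>2 * (?P r)\<^sup>2)) / c + (if r = ?y then v r else 0)"
      using P_pos[of r] by (simp add: B_def distrib_left right_diff_distrib add_divide_distrib)
  qed
  also have "\<dots> = (A - v yhat + 1 / c) + (\<Sum>r=1..K. ?P r * of_bool (r \<noteq> ?y))
      + (\<Sum>r=1..K. ?P r * (1 / (\<beta>\<^sup>2 * (?P r)\<^sup>2))) / c + v ?y"
  proof -
    have "(\<Sum>r=1..K. ?P r * (A - v yhat + 1 / c)) = A - v yhat + 1 / c"
      using K by (subst sum_label_prob_mult[OF yhat]) (simp add: left_diff_distrib)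
    then show ?thesis
      using y by (simp only: sum.distrib sum_divide_distrib) simp
  qed
  also have "\<dots> \<le> (A - v yhat + 1 / c) + (of_bool (yhat \<noteq> ?y) + \<gamma>)
      + ((real K)\<^sup>2 / (\<gamma> * \<beta>\<^sup>2)) / c + v ?y"
    using mistake_prob_le[OF _ \<gamma>(2) yhat, of ?y] \<gamma> c
      divide_right_mono[OF expectation_importance_weight_square_le[OF \<gamma> yhat \<beta>], of c]
    by (intro add_mono order_refl) auto
  also have "\<dots> \<le> A + (\<gamma> + ?L + ((real K)\<^sup>2 / (\<gamma> * \<beta>\<^sup>2) + 1) / c)"
  proof -
    \<comment> \<open>The learner's own matrix contributes nothing positive, since
      \<open>yhat\<close> maximises its scores.\<close>
    have "score d W ?x ?y / c \<le> score d W ?x yhat / c"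
      using argmax_rule_ge[OF amax y, of "score d W ?x"] c
      by (auto simp: yhat_def intro: divide_right_mono)
    \<comment> \<open>For a wrong \<open>yhat\<close> this is the margin bound; for
      \<open>yhat = ?y\<close> the left side is 0 and the loss is nonnegative.\<close>
    moreover have "of_bool (yhat \<noteq> ?y) - score d U ?x ?y + score d U ?x yhat \<le> ?L"
      using hinge_loss_ge_margin[OF yhat y] hinge_loss_nonneg[OF K y] by (cases "yhat = ?y") auto
    ultimately show ?thesis
      by (simp add: v_def add_divide_distrib)
  qed
  finally show ?thesis
    by (simp add: A_def \<beta>_def)
qed

text \<open>The drift bound is the same at every state, so it passes through the expectation and
  adds up over the trials. The potential starts at 0 because the initial matrix is 0.\<close>

lemma expectation_potential_le:
  assumes \<rho>: "\<rho>0 \<in> {0..1}" "\<rho>1 \<in> {0..1}" "\<rho>0 + \<rho>1 < 1"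
    and \<gamma>: "0 < \<gamma>" "\<gamma> \<le> 1" and amax: "argmax_rule K amax" and K: "K \<ge> 2"
    and xy: "\<forall>s\<in>{1..t}. L2_set (x s) {1..d} \<le> 1 \<and> y s \<in> {1..K}" and c: "c > 0"
  shows "measure_pmf.expectation (rcnbf K d amax \<gamma> \<rho>0 \<rho>1 x y t) (potential K d y U c t) \<le>
    real t * (\<gamma> + ((real K)\<^sup>2 / (\<gamma> * (1 - \<rho>0 - \<rho>1)\<^sup>2) + 1) / c)
      + (\<Sum>s=1..t. hinge_loss K d U (x s) (y s))"
  using xy
proof (induction t)
  case 0
  then show ?case by (simp add: potential_def matrix_inner_def)
next
  case (Suc t)
  define G where "G = ((real K)\<^sup>2 / (\<gamma> * (1 - \<rho>0 - \<rho>1)\<^sup>2) + 1) / c"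
  let ?\<delta> = "\<gamma> + hinge_loss K d U (x (Suc t)) (y (Suc t)) + G"
  let ?M = "rcnbf K d amax \<gamma> \<rho>0 \<rho>1 x y t"
  have \<gamma>0: "0 \<le> \<gamma>" using \<gamma> by simp
  note fin = finite_set_rcnbf[OF \<gamma>0 \<gamma>(2) amax] finite_set_rcnbf_step[OF \<gamma>0 \<gamma>(2) amax]
  have "measure_pmf.expectation (rcnbf K d amax \<gamma> \<rho>0 \<rho>1 x y (Suc t))
      (potential K d y U c (Suc t)) =
    measure_pmf.expectation ?M (\<lambda>s. measure_pmf.expectation
      (rcnbf_step K d amax \<gamma> \<rho>0 \<rho>1 x y t s) (potential K d y U c (Suc t)))"
    unfolding rcnbf_Suc by (intro expectation_bind_finite fin)
  also have "\<dots> \<le> measure_pmf.expectation ?M (\<lambda>s. potential K d y U c t s + ?\<delta>)"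
    unfolding G_def using Suc.prems by (intro integral_mono integrable_measure_pmf_finite fin
        expectation_potential_step_le \<rho> \<gamma> amax K c) auto
  also have "\<dots> = measure_pmf.expectation ?M (potential K d y U c t) + ?\<delta>"
    by (subst Bochner_Integration.integral_add)
       (auto intro: integrable_measure_pmf_finite fin)
  finally show ?case
    using Suc unfolding G_def[symmetric] by (simp add: algebra_simps del: rcnbf.simps)
qed

section \<open>Mistake bound and choice of parameters\<close>

lemma expected_mistakes_le:
  assumes \<rho>: "\<rho>0 \<in> {0..1}" "\<rho>1 \<in> {0..1}" "\<rho>0 + \<rho>1 < 1"
    and \<gamma>: "0 < \<gamma>" "\<gamma> \<le> 1" and amax: "argmax_rule K amax" and K: "K \<ge> 2"
    and xy: "\<forall>t\<in>{1..T}. L2_set (x t) {1..d} \<le> 1 \<and> y t \<in> {1..K}" and c: "c > 0"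
  shows "expected_mistakes K d amax \<gamma> \<rho>0 \<rho>1 x y T \<le>
    real T * (\<gamma> + ((real K)\<^sup>2 / (\<gamma> * (1 - \<rho>0 - \<rho>1)\<^sup>2) + 1) / c)
      + (\<Sum>t=1..T. hinge_loss K d U (x t) (y t)) + c / 2 * (frob_norm K d U)\<^sup>2"
proof -
  let ?M = "rcnbf K d amax \<gamma> \<rho>0 \<rho>1 x y T"
  have fin: "finite (set_pmf ?M)"
    using \<gamma> amax by (intro finite_set_rcnbf) auto
  have "expected_mistakes K d amax \<gamma> \<rho>0 \<rho>1 x y T \<le>
      measure_pmf.expectation ?M (\<lambda>s. potential K d y U c T s + c / 2 * matrix_inner K d U U)"
    unfolding expected_mistakes_def
    by (intro integral_mono integrable_measure_pmf_finite fin mistakes_le_potential c)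
  also have "\<dots> = measure_pmf.expectation ?M (potential K d y U c T)
      + c / 2 * matrix_inner K d U U"
    by (subst Bochner_Integration.integral_add) (auto intro: integrable_measure_pmf_finite fin)
  finally show ?thesis
    using expectation_potential_le[OF \<rho> \<gamma> amax K xy c, of U]
    by (simp add: matrix_inner_self_eq_frob_norm)
qed

theorem corollary4p3:
  "\<exists>a>0. \<forall>K\<ge>2. \<forall>D\<ge>0. \<forall>R\<ge>0. \<exists>C::real.
     \<forall>(T::nat)\<ge>1. \<forall>(d::nat) (\<rho>0::real) (\<rho>1::real) (amax :: (nat \<Rightarrow> real) \<Rightarrow> nat)
       (x :: nat \<Rightarrow> nat \<Rightarrow> real) (y :: nat \<Rightarrow> nat) (\<beta>::real) (\<gamma>::real).
       \<rho>0 \<in> {0..1} \<longrightarrow> \<rho>1 \<in> {0..1} \<longrightarrow> \<rho>0 + \<rho>1 < 1 \<longrightarrow>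
       argmax_rule K amax \<longrightarrow>
       (\<forall>t\<in>{1..T}. L2_set (x t) {1..d} \<le> 1 \<and> y t \<in> {1..K}) \<longrightarrow>
       (\<exists>W. (frob_norm K d W)\<^sup>2 = D \<and> (\<Sum>t=1..T. hinge_loss K d W (x t) (y t)) \<le> R) \<longrightarrow>
       \<beta> = 1 - \<rho>0 - \<rho>1 \<longrightarrow>
       \<gamma> = a * real T powr (- 1 / 3) * inverse \<beta> \<longrightarrow>
       \<gamma> \<in> {0<..<1/2} \<longrightarrow>
       expected_mistakes K d amax \<gamma> \<rho>0 \<rho>1 x y T \<le> C * real T powr (2 / 3) * inverse \<beta>"
\<comment> \<open>With a = 1 the total exploration cost T \<gamma> is exactly T^(2/3) /
  \<beta>.\<close>
proof (rule exI[of _ 1], intro conjI allI impI)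
  fix K :: nat and D R :: real
  assume K: "K \<ge> 2" and D: "D \<ge> 0" and R: "R \<ge> 0"
  show "\<exists>C::real.
     \<forall>(T::nat)\<ge>1. \<forall>(d::nat) (\<rho>0::real) (\<rho>1::real) (amax :: (nat \<Rightarrow> real) \<Rightarrow> nat)
       (x :: nat \<Rightarrow> nat \<Rightarrow> real) (y :: nat \<Rightarrow> nat) (\<beta>::real) (\<gamma>::real).
       \<rho>0 \<in> {0..1} \<longrightarrow> \<rho>1 \<in> {0..1} \<longrightarrow> \<rho>0 + \<rho>1 < 1 \<longrightarrow>
       argmax_rule K amax \<longrightarrow>
       (\<forall>t\<in>{1..T}. L2_set (x t) {1..d} \<le> 1 \<and> y t \<in> {1..K}) \<longrightarrow>
       (\<exists>W. (frob_norm K d W)\<^sup>2 = D \<and> (\<Sum>t=1..T. hinge_loss K d W (x t) (y t)) \<le> R) \<longrightarrow>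
       \<beta> = 1 - \<rho>0 - \<rho>1 \<longrightarrow>
       \<gamma> = 1 * real T powr (- 1 / 3) * inverse \<beta> \<longrightarrow>
       \<gamma> \<in> {0<..<1/2} \<longrightarrow>
       expected_mistakes K d amax \<gamma> \<rho>0 \<rho>1 x y T \<le> C * real T powr (2 / 3) * inverse \<beta>"
  \<comment> \<open>In units of T^(2/3) / \<beta>: one unit each for T \<gamma> and T / c, then K^2
    for the importance weights, R for the comparator's loss, and D / 2 for c D / 2.\<close>
  proof (rule exI[of _ "2 + (real K)\<^sup>2 + R + D / 2"], intro allI impI)
    fix T d :: nat and \<rho>0 \<rho>1 :: real and amax :: "(nat \<Rightarrow> real) \<Rightarrow> nat"
      and x :: "nat \<Rightarrow> nat \<Rightarrow> real" and y :: "nat \<Rightarrow> nat" and \<beta> \<gamma> :: real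
    assume T: "T \<ge> 1" and \<rho>: "\<rho>0 \<in> {0..1}" "\<rho>1 \<in> {0..1}" "\<rho>0 + \<rho>1 < 1"
      and amax: "argmax_rule K amax"
      and xy: "\<forall>t\<in>{1..T}. L2_set (x t) {1..d} \<le> 1 \<and> y t \<in> {1..K}"
      and ex: "\<exists>W. (frob_norm K d W)\<^sup>2 = D \<and> (\<Sum>t=1..T. hinge_loss K d W (x t) (y t)) \<le> R"
      and \<beta>_eq: "\<beta> = 1 - \<rho>0 - \<rho>1"
      and \<gamma>_eq: "\<gamma> = 1 * real T powr (- 1 / 3) * inverse \<beta>" and \<gamma>: "\<gamma> \<in> {0<..<1/2}"
    obtain U where U: "(frob_norm K d U)\<^sup>2 = D" "(\<Sum>t=1..T. hinge_loss K d U (x t) (y t)) \<le> R"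
      using ex by blast
    have \<beta>: "0 < \<beta>" "\<beta> \<le> 1"
      using \<rho> by (auto simp: \<beta>_eq)
    define u where "u = real T powr (1 / 3)"
    have u: "u \<ge> 1"
      using T by (simp add: u_def ge_one_powr_ge_zero)
    have u2: "real T powr (2 / 3) = u\<^sup>2" and u3: "real T = u ^ 3"
      using T by (simp_all add: u_def powr_powr flip: powr_numeral)
    have \<gamma>_u: "\<gamma> = 1 / (u * \<beta>)"
      by (simp add: \<gamma>_eq u_def powr_minus_divide field_simps)
    have pos: "u\<^sup>2 / \<beta> > 0"
      using u \<beta> by simp
    \<comment> \<open>With c = u^2 / \<beta>, the summands on the right are T \<gamma>, the
      importance-weight term and T / c. Each is then compared with u^2 / \<beta>, using \<beta>
      \<le> 1 \<le> u.\<close>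
    have "real T * (\<gamma> + ((real K)\<^sup>2 / (\<gamma> * \<beta>\<^sup>2) + 1) / (u\<^sup>2 / \<beta>)) =
        u\<^sup>2 / \<beta> + (real K)\<^sup>2 * u\<^sup>2 + u * \<beta>"
      using u \<beta> by (simp add: u3 \<gamma>_u field_simps power2_eq_square power3_eq_cube)
    moreover have "(real K)\<^sup>2 * u\<^sup>2 \<le> (real K)\<^sup>2 * (u\<^sup>2 / \<beta>)"
      using u \<beta> by (intro mult_left_mono) (simp_all add: field_simps)
    moreover have "u * \<beta> \<le> u\<^sup>2 / \<beta>"
    proof -
      have "u * \<beta> * \<beta> \<le> u * 1 * 1"
        using u \<beta> by (intro mult_mono) auto
      also have "\<dots> \<le> u * u"
        using u by simp
      finally show ?thesis
        using \<beta> by (simp add: field_simps power2_eq_square)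
    qed
    moreover have "R \<le> R * (u\<^sup>2 / \<beta>)"
    proof -
      have "\<beta> \<le> u\<^sup>2"
        using one_le_power[OF u, of 2] \<beta> by linarith
      then have "1 \<le> u\<^sup>2 / \<beta>"
        using \<beta> by simp
      then have "R * 1 \<le> R * (u\<^sup>2 / \<beta>)"
        using R by (rule mult_left_mono)
      then show ?thesis by simp
    qed
    moreover have "expected_mistakes K d amax \<gamma> \<rho>0 \<rho>1 x y T \<le>
        real T * (\<gamma> + ((real K)\<^sup>2 / (\<gamma> * \<beta>\<^sup>2) + 1) / (u\<^sup>2 / \<beta>))
        + (\<Sum>t=1..T. hinge_loss K d U (x t) (y t)) + u\<^sup>2 / \<beta> / 2 * (frob_norm K d U)\<^sup>2"
      unfolding \<beta>_eq using \<gamma> pos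
      by (intro expected_mistakes_le \<rho> amax K xy) (auto simp: \<beta>_eq)
    ultimately have "expected_mistakes K d amax \<gamma> \<rho>0 \<rho>1 x y T \<le>
        (2 + (real K)\<^sup>2 + R + D / 2) * (u\<^sup>2 / \<beta>)"
      using U by (simp add: algebra_simps)
    then show "expected_mistakes K d amax \<gamma> \<rho>0 \<rho>1 x y T \<le>
        (2 + (real K)\<^sup>2 + R + D / 2) * real T powr (2 / 3) * inverse \<beta>"
      by (simp only: u2 divide_inverse[of "u\<^sup>2"] mult.assoc)
  qed
qed simp

end
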